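(* Let $p\ge 3$ be a prime, let $a,b\in\mathcal{E}_p$ with $b\neq 1$, and let $$g_{a,b}(u)=a\left(\frac{b^2u^2+1}{b^2+u^2}\right).$$ Then the following statements hold: (i) the function $g_{a,b}$ has a unique fixed point $x_0$ in $\mathcal{E}_p$; (ii) if $p\equiv 3 \pmod 4$, then $x_0$ is the only fixed point of $g_{a,b}$ (in $\mathbb{Q}_p$); if $p\equiv 1\pmod 4$, then $g_{a,b}$ has two fixed points $x_1,x_2$ (in $\mathbb{Q}_p$) different from $x_0$; (iii) if $x_1,x_2$ are two fixed points of $g_{a,b}$ different from $x_0$, then $x_1,x_2\in\mathbb{Q}_p\setminus\mathcal{E}_p$.
   Context: $\mathbb{Q}_p$ is the field of $p$-adic numbers with the $p$-adic absolute value $|\cdot|_p$ normalized by $|p|_p=1/p$. $\mathcal{E}_p=\{x\in\mathbb{Q}_p:\ |x-1|_p<1\}$. A fixed point of $g_{a,b}$ is an $x\in\mathbb{Q}_p$ with $b^2+x^2\ne 0$ and $g_{a,b}(x)=x$. *)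

theory Defs
  imports Complex_Main "Berlekamp_Zassenhaus.Finite_Field"
begin

section \<open>The p-adic absolute value on the rationals\<close>

definition padic_abs :: "nat \<Rightarrow> rat \<Rightarrow> real" where
  "padic_abs p q =
    (if q = 0 then 0
     else real p powi (int (multiplicity (int p) (snd (quotient_of q)))
                       - int (multiplicity (int p) (fst (quotient_of q)))))"

lemma padic_abs_0 [simp]: "padic_abs p 0 = 0"
  by (simp add: padic_abs_def)

lemma padic_abs_quotient:
  assumes p: "prime p" and nz: "a \<noteq> 0" "b \<noteq> 0"
  shows "padic_abs p (of_int a / of_int b)
    = real p powi (int (multiplicity (int p) b) - int (multiplicity (int p) a))"
proof -
  define q :: rat where "q = of_int a / of_int b"
  obtain n d where nd: "quotient_of q = (n, d)" by (cases "quotient_of q")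
  have d: "d > 0" and q: "q = of_int n / of_int d"
    using nd by (auto intro: quotient_of_denom_pos quotient_of_div)
  have q0: "q \<noteq> 0" using nz by (simp add: q_def)
  hence n: "n \<noteq> 0" using q by auto
  have "(of_int (a * d) :: rat) = of_int (n * b)"
    using q nz d by (simp add: q_def field_simps)
  hence eq: "a * d = n * b" by (simp only: of_int_eq_iff)
  have pe: "prime_elem (int p)" using p by simp
  have "multiplicity (int p) a + multiplicity (int p) d
      = multiplicity (int p) n + multiplicity (int p) b"
    using prime_elem_multiplicity_mult_distrib[OF pe, of a d]
      prime_elem_multiplicity_mult_distrib[OF pe, of n b] nz d n eq by simp
  hence "int (multiplicity (int p) d) - int (multiplicity (int p) n)
      = int (multiplicity (int p) b) - int (multiplicity (int p) a)"
    by linarith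
  thus ?thesis using q0 nd by (simp add: padic_abs_def flip: q_def)
qed

lemma rat_as_quotient:
  fixes q :: rat
  obtains a b where "q = of_int a / of_int b" "b \<noteq> 0"
proof -
  obtain n d where "quotient_of q = (n, d)" by (cases "quotient_of q")
  with that[of n d] show ?thesis
    using quotient_of_div[of q n d] quotient_of_denom_pos[of q n d] by auto
qed

lemma padic_abs_mult:
  assumes p: "prime p"
  shows "padic_abs p (x * y) = padic_abs p x * padic_abs p y"
proof (cases "x = 0 \<or> y = 0")
  case False
  obtain a b where x: "x = of_int a / of_int b" and b: "b \<noteq> 0" by (rule rat_as_quotient)
  obtain c d where y: "y = of_int c / of_int d" and d: "d \<noteq> 0" by (rule rat_as_quotient)
  have a: "a \<noteq> 0" and c: "c \<noteq> 0" using False x y by auto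
  have xy: "x * y = of_int (a * c) / of_int (b * d)" by (simp add: x y)
  have pe: "prime_elem (int p)" using p by simp
  have p0: "real p \<noteq> 0" using p prime_gt_0_nat by force
  have "padic_abs p (x * y) = real p powi
    ((int (multiplicity (int p) b) - int (multiplicity (int p) a))
     + (int (multiplicity (int p) d) - int (multiplicity (int p) c)))"
    unfolding xy using a b c d
    by (subst padic_abs_quotient[OF p])
      (simp_all add: prime_elem_multiplicity_mult_distrib[OF pe] algebra_simps)
  also have "\<dots> = padic_abs p x * padic_abs p y"
    using p0 a b c d by (simp add: x y padic_abs_quotient[OF p] power_int_add)
  finally show ?thesis .
qed auto

lemma padic_abs_nonneg: "padic_abs p x \<ge> 0"
  by (simp add: padic_abs_def)

lemma padic_abs_eq_0: "prime p \<Longrightarrow> padic_abs p x = 0 \<longleftrightarrow> x = 0"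
  by (auto simp: padic_abs_def dest: prime_gt_0_nat)

lemma padic_abs_1: "prime p \<Longrightarrow> padic_abs p 1 = 1"
  using padic_abs_quotient[of p 1 1] by simp

lemma padic_abs_minus: "padic_abs p (- x) = padic_abs p x"
  by (simp add: padic_abs_def rat_uminus_code case_prod_beta multiplicity_def)

lemma padic_abs_minus_commute: "padic_abs p (x - y) = padic_abs p (y - x)"
  using padic_abs_minus[of p "y - x"] by simp

lemma padic_abs_inverse:
  assumes "prime p"
  shows "padic_abs p (inverse x) = inverse (padic_abs p x)"
proof (cases "x = 0")
  case False
  hence "padic_abs p x * padic_abs p (inverse x) = 1"
    using padic_abs_mult[OF assms, of x "inverse x"] padic_abs_1[OF assms] by simp
  thus ?thesis by (metis inverse_unique)
qed simp

lemma padic_abs_add: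
  assumes p: "prime p"
  shows "padic_abs p (x + y) \<le> max (padic_abs p x) (padic_abs p y)"
proof (cases "x = 0 \<or> y = 0 \<or> x + y = 0")
  case True
  thus ?thesis by (auto simp: padic_abs_nonneg le_max_iff_disj)
next
  case False
  obtain a b where x: "x = of_int a / of_int b" and b: "b \<noteq> 0" by (rule rat_as_quotient)
  obtain c d where y: "y = of_int c / of_int d" and d: "d \<noteq> 0" by (rule rat_as_quotient)
  let ?m = "\<lambda>k. multiplicity (int p) k"
  have x': "x = of_int (a * d) / of_int (b * d)" and y': "y = of_int (c * b) / of_int (b * d)"
    using b d by (simp_all add: x y)
  have xy: "x + y = of_int (a * d + c * b) / of_int (b * d)"
    using b d by (simp add: x y field_simps)
  have nz: "a * d \<noteq> 0" "c * b \<noteq> 0" "b * d \<noteq> 0"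
    using False b d x y by auto
  have nz2: "a * d + c * b \<noteq> 0"
  proof
    assume "a * d + c * b = 0"
    with xy have "x + y = 0" by simp
    with False show False by simp
  qed
  have nu: "\<not> is_unit (int p)" using prime_gt_1_nat[OF p] by simp
  have "int p ^ min (?m (a * d)) (?m (c * b)) dvd a * d + c * b"
    by (intro dvd_add multiplicity_dvd') auto
  hence "min (?m (a * d)) (?m (c * b)) \<le> ?m (a * d + c * b)"
    by (intro multiplicity_geI nz2 nu)
  hence "?m (a * d) \<le> ?m (a * d + c * b) \<or> ?m (c * b) \<le> ?m (a * d + c * b)"
    by linarith
  moreover have "1 \<le> real p" using prime_ge_1_nat[OF p] by simp
  moreover have "padic_abs p (x + y) = real p powi (int (?m (b * d)) - int (?m (a * d + c * b)))"
    unfolding xy by (rule padic_abs_quotient[OF p nz2 nz(3)])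
  moreover have "padic_abs p x = real p powi (int (?m (b * d)) - int (?m (a * d)))"
    unfolding x' by (rule padic_abs_quotient[OF p nz(1) nz(3)])
  moreover have "padic_abs p y = real p powi (int (?m (b * d)) - int (?m (c * b)))"
    unfolding y' by (rule padic_abs_quotient[OF p nz(2) nz(3)])
  ultimately show ?thesis
    by (auto simp: le_max_iff_disj intro!: power_int_increasing)
qed

lemma padic_abs_add_le:
  assumes "prime p"
  shows "padic_abs p (x + y) \<le> padic_abs p x + padic_abs p y"
  using padic_abs_add[OF assms, of x y] padic_abs_nonneg[of p x] padic_abs_nonneg[of p y] by linarith

lemma padic_abs_diff_le:
  assumes "prime p"
  shows "\<bar>padic_abs p x - padic_abs p y\<bar> \<le> padic_abs p (x - y)"
  using padic_abs_add_le[OF assms, of "x - y" y] padic_abs_add_le[OF assms, of "y - x" x]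
    padic_abs_minus_commute[of p x y] by simp


section \<open>Cauchy sequences and null sequences\<close>

definition padic_Cauchy :: "nat \<Rightarrow> (nat \<Rightarrow> rat) \<Rightarrow> bool" where
  "padic_Cauchy p X \<longleftrightarrow> (\<forall>e>0. \<exists>N. \<forall>m\<ge>N. \<forall>n\<ge>N. padic_abs p (X m - X n) < e)"

definition padic_null :: "nat \<Rightarrow> (nat \<Rightarrow> rat) \<Rightarrow> bool" where
  "padic_null p X \<longleftrightarrow> (\<lambda>n. padic_abs p (X n)) \<longlonglongrightarrow> 0"

lemma padic_null_add:
  assumes "prime p" "padic_null p X" "padic_null p Y"
  shows "padic_null p (\<lambda>n. X n + Y n)"
  unfolding padic_null_def
proof (rule tendsto_sandwich[OF _ _ tendsto_const])
  show "(\<lambda>n. padic_abs p (X n) + padic_abs p (Y n)) \<longlonglongrightarrow> 0"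
    using tendsto_add assms(2,3) unfolding padic_null_def by fastforce
qed (auto intro!: always_eventually padic_abs_nonneg padic_abs_add_le assms(1))

lemma padic_null_minus: "padic_null p (\<lambda>n. - X n) \<longleftrightarrow> padic_null p X"
  by (simp add: padic_null_def padic_abs_minus)

lemma padic_null_cong:
  assumes "prime p" "padic_null p (\<lambda>n. X n - Y n)"
  shows "padic_null p X \<longleftrightarrow> padic_null p Y"
  using padic_null_add[OF assms(1), of "\<lambda>n. X n - Y n" Y]
    padic_null_add[OF assms(1), of "\<lambda>n. - (X n - Y n)" X] assms(2)
    padic_null_minus[of p "\<lambda>n. X n - Y n"] by auto

lemma padic_Cauchy_const [simp]: "padic_Cauchy p (\<lambda>n. c)"
  by (simp add: padic_Cauchy_def)

lemma padic_Cauchy_abs: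
  assumes "prime p" "padic_Cauchy p X"
  shows "convergent (\<lambda>n. padic_abs p (X n))"
proof (rule real_Cauchy_convergent, rule CauchyI)
  fix e :: real
  assume "e > 0"
  then obtain N where "\<forall>m\<ge>N. \<forall>n\<ge>N. padic_abs p (X m - X n) < e"
    using assms(2) unfolding padic_Cauchy_def by blast
  thus "\<exists>N. \<forall>m\<ge>N. \<forall>n\<ge>N. norm (padic_abs p (X m) - padic_abs p (X n)) < e"
    using padic_abs_diff_le[OF assms(1)] by (metis real_norm_def le_less_trans)
qed

lemma padic_Cauchy_bounded:
  assumes "prime p" "padic_Cauchy p X"
  obtains B where "B > 0" "\<And>n. padic_abs p (X n) \<le> B"
proof -
  have "Bseq (\<lambda>n. padic_abs p (X n))"
    using padic_Cauchy_abs[OF assms] by (rule convergent_imp_Bseq)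
  thus ?thesis
    using that by (auto simp: Bseq_def padic_abs_nonneg)
qed

lemma padic_null_mult:
  assumes p: "prime p" and "padic_Cauchy p X" "padic_null p Y"
  shows "padic_null p (\<lambda>n. X n * Y n)"
proof -
  have "Bseq (\<lambda>n. padic_abs p (X n))"
    using padic_Cauchy_abs[OF assms(1,2)] by (rule convergent_imp_Bseq)
  moreover have "Zfun (\<lambda>n. padic_abs p (Y n)) sequentially"
    using assms(3) by (simp add: padic_null_def tendsto_Zfun_iff)
  ultimately have "Zfun (\<lambda>n. padic_abs p (X n) * padic_abs p (Y n)) sequentially"
    by (intro bounded_bilinear.Bfun_prod_Zfun[OF bounded_bilinear_mult])
  thus ?thesis by (simp add: padic_null_def tendsto_Zfun_iff padic_abs_mult[OF p])
qed

lemma padic_Cauchy_minus: "padic_Cauchy p X \<Longrightarrow> padic_Cauchy p (\<lambda>n. - X n)"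
  by (simp add: padic_Cauchy_def padic_abs_minus_commute)

lemma padic_Cauchy_add:
  assumes p: "prime p" and "padic_Cauchy p X" "padic_Cauchy p Y"
  shows "padic_Cauchy p (\<lambda>n. X n + Y n)"
  unfolding padic_Cauchy_def
proof (intro allI impI)
  fix e :: real
  assume e: "e > 0"
  obtain M where M: "\<And>m n. m \<ge> M \<Longrightarrow> n \<ge> M \<Longrightarrow> padic_abs p (X m - X n) < e"
    using assms(2) e unfolding padic_Cauchy_def by blast
  obtain N where N: "\<And>m n. m \<ge> N \<Longrightarrow> n \<ge> N \<Longrightarrow> padic_abs p (Y m - Y n) < e"
    using assms(3) e unfolding padic_Cauchy_def by blast
  have "padic_abs p (X m + Y m - (X n + Y n)) < e" if "m \<ge> max M N" "n \<ge> max M N" for m n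
    using padic_abs_add[OF p, of "X m - X n" "Y m - Y n"] M[of m n] N[of m n] that
    by (simp add: algebra_simps)
  thus "\<exists>N. \<forall>m\<ge>N. \<forall>n\<ge>N. padic_abs p (X m + Y m - (X n + Y n)) < e" by blast
qed

lemma padic_Cauchy_mult:
  assumes p: "prime p" and "padic_Cauchy p X" "padic_Cauchy p Y"
  shows "padic_Cauchy p (\<lambda>n. X n * Y n)"
  unfolding padic_Cauchy_def
proof (intro allI impI)
  fix e :: real
  assume e: "e > 0"
  obtain B where B: "B > 0" "\<And>n. padic_abs p (X n) \<le> B"
    using padic_Cauchy_bounded[OF assms(1,2)] by blast
  obtain C where C: "C > 0" "\<And>n. padic_abs p (Y n) \<le> C"
    using padic_Cauchy_bounded[OF assms(1,3)] by blast
  obtain M where M: "\<And>m n. m \<ge> M \<Longrightarrow> n \<ge> M \<Longrightarrow> padic_abs p (X m - X n) < e / C"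
    using assms(2) e C(1) unfolding padic_Cauchy_def by (meson divide_pos_pos)
  obtain N where N: "\<And>m n. m \<ge> N \<Longrightarrow> n \<ge> N \<Longrightarrow> padic_abs p (Y m - Y n) < e / B"
    using assms(3) e B(1) unfolding padic_Cauchy_def by (meson divide_pos_pos)
  have "padic_abs p (X m * Y m - X n * Y n) < e" if "m \<ge> max M N" "n \<ge> max M N" for m n
  proof -
    have "padic_abs p (X m * (Y m - Y n)) \<le> B * padic_abs p (Y m - Y n)"
      unfolding padic_abs_mult[OF p] by (intro mult_right_mono B padic_abs_nonneg)
    also have "\<dots> < e" using N[of m n] that B(1) by (simp add: field_simps)
    finally have 1: "padic_abs p (X m * (Y m - Y n)) < e" .
    have "padic_abs p ((X m - X n) * Y n) \<le> padic_abs p (X m - X n) * C"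
      unfolding padic_abs_mult[OF p] by (intro mult_left_mono C padic_abs_nonneg)
    also have "\<dots> < e" using M[of m n] that C(1) by (simp add: field_simps)
    finally have 2: "padic_abs p ((X m - X n) * Y n) < e" .
    have "X m * Y m - X n * Y n = X m * (Y m - Y n) + (X m - X n) * Y n"
      by (simp add: algebra_simps)
    thus ?thesis
      using padic_abs_add[OF p, of "X m * (Y m - Y n)" "(X m - X n) * Y n"] 1 2 by simp
  qed
  thus "\<exists>N. \<forall>m\<ge>N. \<forall>n\<ge>N. padic_abs p (X m * Y m - X n * Y n) < e" by blast
qed

lemma padic_Cauchy_not_null:
  assumes p: "prime p" and "padic_Cauchy p X" "\<not> padic_null p X"
  obtains c N where "c > 0" "\<And>n. n \<ge> N \<Longrightarrow> padic_abs p (X n) \<ge> c"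
proof -
  obtain L where L: "(\<lambda>n. padic_abs p (X n)) \<longlonglongrightarrow> L"
    using padic_Cauchy_abs[OF assms(1,2)] by (auto simp: convergent_def)
  have "L \<ge> 0"
    by (rule tendsto_lowerbound[OF L]) (auto simp: padic_abs_nonneg)
  moreover have "L \<noteq> 0" using L assms(3) by (auto simp: padic_null_def)
  ultimately have "L > L / 2" "L / 2 > 0" by auto
  moreover from order_tendstoD(1)[OF L this(1)]
  obtain N where "\<And>n. n \<ge> N \<Longrightarrow> padic_abs p (X n) > L / 2"
    by (auto simp: eventually_sequentially)
  ultimately show ?thesis using that[of "L / 2" N] by force
qed

lemma padic_Cauchy_inverse:
  assumes p: "prime p" and X: "padic_Cauchy p X" "\<not> padic_null p X"
  shows "padic_Cauchy p (\<lambda>n. inverse (X n))"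
  unfolding padic_Cauchy_def
proof (intro allI impI)
  fix e :: real
  assume e: "e > 0"
  obtain c N where c: "c > 0" "\<And>n. n \<ge> N \<Longrightarrow> padic_abs p (X n) \<ge> c"
    using padic_Cauchy_not_null[OF assms] by blast
  have "e * c * c > 0" using e c(1) by simp
  then obtain M where M: "\<And>m n. m \<ge> M \<Longrightarrow> n \<ge> M \<Longrightarrow> padic_abs p (X m - X n) < e * c * c"
    using X(1) unfolding padic_Cauchy_def by blast
  have "padic_abs p (inverse (X m) - inverse (X n)) < e" if "m \<ge> max M N" "n \<ge> max M N" for m n
  proof -
    have a: "padic_abs p (X m) \<ge> c" "padic_abs p (X n) \<ge> c" using c(2) that by auto
    hence nz: "X m \<noteq> 0" "X n \<noteq> 0" using c(1) by auto
    have "padic_abs p (inverse (X m) - inverse (X n))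
        = inverse (padic_abs p (X m)) * padic_abs p (X m - X n) * inverse (padic_abs p (X n))"
      unfolding inverse_diff_inverse[OF nz]
      by (simp add: padic_abs_minus padic_abs_mult[OF p] padic_abs_inverse[OF p])
    also have "\<dots> \<le> inverse c * padic_abs p (X m - X n) * inverse c"
      using a c(1) by (intro mult_mono le_imp_inverse_le) (auto simp: padic_abs_nonneg)
    also have "\<dots> < e" using M[of m n] that c(1) by (simp add: field_simps)
    finally show ?thesis .
  qed
  thus "\<exists>N. \<forall>m\<ge>N. \<forall>n\<ge>N. padic_abs p (inverse (X m) - inverse (X n)) < e" by blast
qed

lemma padic_null_inverse_mult:
  assumes p: "prime p" and X: "padic_Cauchy p X" "\<not> padic_null p X"
  shows "padic_null p (\<lambda>n. inverse (X n) * X n - 1)"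
proof -
  obtain c N where c: "c > 0" "\<And>n. n \<ge> N \<Longrightarrow> padic_abs p (X n) \<ge> c"
    using padic_Cauchy_not_null[OF assms] by blast
  have "padic_abs p (inverse (X n) * X n - 1) = 0" if "n \<ge> N" for n
    using c(1) c(2)[OF that] by (cases "X n = 0") auto
  thus ?thesis
    unfolding padic_null_def by (intro tendsto_eventually eventually_sequentiallyI)
qed

lemma padic_null_diff_inverse:
  assumes p: "prime p"
    and X: "padic_Cauchy p X" "\<not> padic_null p X"
    and Y: "padic_Cauchy p Y" "\<not> padic_null p Y"
    and XY: "padic_null p (\<lambda>n. X n - Y n)"
  shows "padic_null p (\<lambda>n. inverse (X n) - inverse (Y n))"
proof -
  note iX = padic_Cauchy_inverse[OF p X] and iY = padic_Cauchy_inverse[OF p Y]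
  have "padic_null p (\<lambda>n. (- (inverse (X n) * inverse (Y n))) * (X n - Y n))"
    by (intro padic_null_mult padic_Cauchy_minus padic_Cauchy_mult p iX iY XY)
  moreover have "padic_null p (\<lambda>n. inverse (Y n) * (inverse (X n) * X n - 1))"
    by (intro padic_null_mult p iY padic_null_inverse_mult X)
  moreover have "padic_null p (\<lambda>n. - (inverse (X n) * (inverse (Y n) * Y n - 1)))"
    unfolding padic_null_minus by (intro padic_null_mult p iX padic_null_inverse_mult Y)
  ultimately have "padic_null p (\<lambda>n. ((- (inverse (X n) * inverse (Y n))) * (X n - Y n)
      + inverse (Y n) * (inverse (X n) * X n - 1))
      + - (inverse (X n) * (inverse (Y n) * Y n - 1)))"
    by (intro padic_null_add p)
  thus ?thesis by (simp add: algebra_simps)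
qed


section \<open>The field of p-adic numbers\<close>

text \<open>
  The p-adic numbers are the completion of the rationals with respect to the p-adic absolute
  value: the ring of Cauchy sequences modulo the null sequences. The prime p is the
  cardinality of the type parameter, so that for each p there is one type and one field.
  The ring of Cauchy sequences is a type of its own because the quotient package does not
  allow a phantom parameter in the relation.
\<close>

typedef 'p padic_seq = "{X. padic_Cauchy CARD('p::prime_card) X}"
  morphisms seq_of Padic_seq
  by (rule exI[of _ "\<lambda>n. 0"]) simp

setup_lifting type_definition_padic_seq

instantiation padic_seq :: (prime_card) comm_ring_1
begin

lift_definition zero_padic_seq :: "'a padic_seq" is "\<lambda>n. 0" by simp

lift_definition one_padic_seq :: "'a padic_seq" is "\<lambda>n. 1" by simp

lift_definition plus_padic_seq :: "'a padic_seq \<Rightarrow> 'a padic_seq \<Rightarrow> 'a padic_seq"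
  is "\<lambda>X Y n. X n + Y n"
  by (simp add: padic_Cauchy_add prime_card)

lift_definition uminus_padic_seq :: "'a padic_seq \<Rightarrow> 'a padic_seq" is "\<lambda>X n. - X n"
  by (rule padic_Cauchy_minus)

lift_definition minus_padic_seq :: "'a padic_seq \<Rightarrow> 'a padic_seq \<Rightarrow> 'a padic_seq"
  is "\<lambda>X Y n. X n - Y n"
  using padic_Cauchy_add[OF prime_card] padic_Cauchy_minus by fastforce

lift_definition times_padic_seq :: "'a padic_seq \<Rightarrow> 'a padic_seq \<Rightarrow> 'a padic_seq"
  is "\<lambda>X Y n. X n * Y n"
  by (simp add: padic_Cauchy_mult prime_card)

instance
  by standard (transfer; simp add: fun_eq_iff algebra_simps)+

end

lift_definition null_seq :: "'p::prime_card padic_seq \<Rightarrow> bool" is "padic_null CARD('p)" .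

definition padic_rel :: "'p::prime_card padic_seq \<Rightarrow> 'p padic_seq \<Rightarrow> bool" where
  "padic_rel X Y \<longleftrightarrow> null_seq (X - Y)"

lemma null_seq_0 [simp]: "null_seq 0"
  by transfer (simp add: padic_null_def)

lemma null_seq_add: "null_seq X \<Longrightarrow> null_seq Y \<Longrightarrow> null_seq (X + Y)"
  by transfer (rule padic_null_add[OF prime_card])

lemma null_seq_minus: "null_seq X \<Longrightarrow> null_seq (- X)"
  by transfer (simp add: padic_null_minus)

lemma null_seq_mult: "null_seq Y \<Longrightarrow> null_seq (X * Y)"
  by transfer (rule padic_null_mult[OF prime_card])

lemma equivp_padic_rel: "equivp padic_rel"
proof (rule equivpI)
  show "reflp padic_rel"
    by (simp add: reflp_def padic_rel_def)
  show "symp padic_rel"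
    using null_seq_minus by (fastforce simp: symp_def padic_rel_def)
  show "transp padic_rel"
    using null_seq_add by (fastforce simp: transp_def padic_rel_def)
qed

quotient_type 'p padic = "'p::prime_card padic_seq" / padic_rel
  by (rule equivp_padic_rel)

lift_definition inverse_seq :: "'p::prime_card padic_seq \<Rightarrow> 'p padic_seq"
  is "\<lambda>X. if padic_null CARD('p) X then (\<lambda>n. 0) else (\<lambda>n. inverse (X n))"
  by (simp add: padic_Cauchy_inverse prime_card)

lemma inverse_seq_cong:
  "padic_rel X Y \<Longrightarrow> padic_rel (inverse_seq X) (inverse_seq Y)"
  for X Y :: "'p::prime_card padic_seq"
  unfolding padic_rel_def
proof transfer
  fix X Y :: "nat \<Rightarrow> rat"
  assume *: "padic_Cauchy CARD('p) X" "padic_Cauchy CARD('p) Y"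
    "padic_null CARD('p) (\<lambda>n. X n - Y n)"
  show "padic_null CARD('p) (\<lambda>n.
      (if padic_null CARD('p) X then (\<lambda>n. 0) else (\<lambda>n. inverse (X n))) n -
      (if padic_null CARD('p) Y then (\<lambda>n. 0) else (\<lambda>n. inverse (Y n))) n)"
    using padic_null_cong[OF prime_card *(3)] padic_null_diff_inverse[OF prime_card *(1) _ *(2) _ *(3)]
    by (auto simp: padic_null_def)
qed

lemma inverse_seq_mult:
  "\<not> null_seq X \<Longrightarrow> null_seq (inverse_seq X * X - 1)"
  by transfer (simp add: padic_null_inverse_mult prime_card)

lemma inverse_seq_0: "inverse_seq 0 = 0"
  by transfer (simp add: padic_null_def)

lemma not_null_seq_1: "\<not> null_seq 1"
  by transfer (simp add: padic_null_def padic_abs_1 prime_card LIMSEQ_const_iff)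

instantiation padic :: (prime_card) field
begin

lift_definition zero_padic :: "'a padic" is 0 .

lift_definition one_padic :: "'a padic" is 1 .

lift_definition plus_padic :: "'a padic \<Rightarrow> 'a padic \<Rightarrow> 'a padic" is "(+)"
  unfolding padic_rel_def add_diff_add by (rule null_seq_add)

lift_definition uminus_padic :: "'a padic \<Rightarrow> 'a padic" is uminus
  unfolding padic_rel_def minus_diff_minus by (rule null_seq_minus)

lift_definition times_padic :: "'a padic \<Rightarrow> 'a padic \<Rightarrow> 'a padic" is "(*)"
proof -
  fix X X' Y Y' :: "'a padic_seq"
  assume "padic_rel X X'" "padic_rel Y Y'"
  hence "null_seq (X * (Y - Y') + Y' * (X - X'))"
    unfolding padic_rel_def by (intro null_seq_add null_seq_mult)
  thus "padic_rel (X * Y) (X' * Y')"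
    by (simp add: padic_rel_def algebra_simps)
qed

lift_definition inverse_padic :: "'a padic \<Rightarrow> 'a padic" is inverse_seq
  by (rule inverse_seq_cong)

definition "x - y = x + - y" for x y :: "'a padic"

definition "x div y = x * inverse y" for x y :: "'a padic"

instance
proof
  fix a b c :: "'a padic"
  note [simp] = padic_rel_def
  show "a + b = b + a"
    by transfer (simp add: ac_simps)
  show "(a + b) + c = a + (b + c)"
    by transfer (simp add: ac_simps)
  show "0 + a = a"
    by transfer simp
  show "- a + a = 0"
    by transfer simp
  show "a - b = a + - b"
    by (rule minus_padic_def)
  show "(a * b) * c = a * (b * c)"
    by transfer (simp add: ac_simps)
  show "a * b = b * a"
    by transfer (simp add: ac_simps)
  show "1 * a = a"
    by transfer simp
  show "(a + b) * c = a * c + b * c"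
    by transfer (simp add: distrib_right)
  show "(0 :: 'a padic) \<noteq> 1"
    by transfer (use not_null_seq_1 null_seq_minus in fastforce)
  show "a \<noteq> 0 \<Longrightarrow> inverse a * a = 1"
    by transfer (simp add: inverse_seq_mult)
  show "a div b = a * inverse b"
    by (rule divide_padic_def)
  show "inverse (0 :: 'a padic) = 0"
    by transfer (simp add: inverse_seq_0)
qed

end

text \<open>
  The p-adic absolute value of the class of X is the limit of the absolute values of the X n.
  The constant norm of the library cannot be used: it is reserved for real vector spaces.
\<close>

lift_definition norm_seq :: "'p::prime_card padic_seq \<Rightarrow> real"
  is "\<lambda>X. lim (\<lambda>n. padic_abs CARD('p) (X n))" .

lemma norm_seq_cong: "null_seq (X - Y) \<Longrightarrow> norm_seq X = norm_seq Y"
  for X Y :: "'p::prime_card padic_seq"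
proof transfer
  fix X Y :: "nat \<Rightarrow> rat"
  assume *: "padic_Cauchy CARD('p) X" "padic_Cauchy CARD('p) Y"
    "padic_null CARD('p) (\<lambda>n. X n - Y n)"
  note p = prime_card[where 'a='p]
  obtain L where L: "(\<lambda>n. padic_abs CARD('p) (Y n)) \<longlonglongrightarrow> L"
    using padic_Cauchy_abs[OF p *(2)] by (auto simp: convergent_def)
  have "(\<lambda>n. padic_abs CARD('p) (X n - Y n)) \<longlonglongrightarrow> 0"
    using * by (simp add: padic_null_def)
  hence "(\<lambda>n. padic_abs CARD('p) (X n) - padic_abs CARD('p) (Y n)) \<longlonglongrightarrow> 0"
    by (rule tendsto_0_le[where K = 1])
      (simp add: padic_abs_diff_le[OF p] padic_abs_nonneg)
  from tendsto_add[OF this L] have "(\<lambda>n. padic_abs CARD('p) (X n)) \<longlonglongrightarrow> L" by simp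
  with L show "lim (\<lambda>n. padic_abs CARD('p) (X n)) = lim (\<lambda>n. padic_abs CARD('p) (Y n))"
    by (simp add: limI)
qed

lift_definition padic_norm :: "'p::prime_card padic \<Rightarrow> real" is norm_seq
  unfolding padic_rel_def by (rule norm_seq_cong)

lemma of_nat_padic_seq: "seq_of (of_nat k) = (\<lambda>n. of_nat k)"
  by (induction k) (simp_all add: zero_padic_seq.rep_eq one_padic_seq.rep_eq plus_padic_seq.rep_eq)

lemma of_nat_padic: "of_nat k = abs_padic (of_nat k)"
  by (induction k) (simp_all add: zero_padic_def one_padic_def plus_padic.abs_eq)

lemma padic_norm_of_nat:
  "padic_norm (of_nat k :: 'p::prime_card padic) = padic_abs CARD('p) (of_nat k)"
  by (simp add: of_nat_padic padic_norm.abs_eq norm_seq.rep_eq of_nat_padic_seq)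

lemma padic_norm_p: "padic_norm (of_nat CARD('p) :: 'p::prime_card padic) = 1 / CARD('p)"
proof -
  have p: "prime CARD('p)" by (rule prime_card)
  have "padic_abs CARD('p) (of_nat CARD('p)) = 1 / CARD('p)"
    using padic_abs_quotient[OF p, of "int CARD('p)" 1] p prime_gt_1_nat[OF p]
    by (simp add: power_int_minus field_simps)
  thus ?thesis by (simp add: padic_norm_of_nat)
qed


section \<open>The map and its fixed points\<close>

definition E_padic :: "'p::prime_card padic set" where
  "E_padic = {x. padic_norm (x - 1) < 1}"

definition g_map :: "'p::prime_card padic \<Rightarrow> 'p padic \<Rightarrow> 'p padic \<Rightarrow> 'p padic" where
  "g_map a b u = a * ((b^2 * u^2 + 1) / (b^2 + u^2))"

text \<open>
  Division by zero yields zero in HOL, hence the explicit condition on the denominator.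
\<close>

definition fixed_points :: "'p::prime_card padic \<Rightarrow> 'p padic \<Rightarrow> 'p padic set" where
  "fixed_points a b = {x. b^2 + x^2 \<noteq> 0 \<and> g_map a b x = x}"

end

theory Submission
  imports Defs "HOL-Analysis.Elementary_Metric_Spaces" "HOL-Number_Theory.Euler_Criterion"
begin

text \<open>
  For \<open>b \<noteq> 1\<close> in the unit ball around 1, the fixed points are exactly the roots of the monic cubic
  \<open>f x = x (b\<^sup>2 + x\<^sup>2) - a (b\<^sup>2 x\<^sup>2 + 1)\<close>: at a root where the denominator \<open>b\<^sup>2 + x\<^sup>2\<close> vanished, one
  would have \<open>a (1 - b\<^sup>4) = 0\<close>, which is impossible because \<open>b + 1\<close> and \<open>b\<^sup>2 + 1\<close> are congruent to 2
  (\<open>fixed_points_eq_roots\<close>). Since \<open>a\<close> and \<open>b\<close> are congruent to 1 modulo p, the cubic is congruent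
  to \<open>(x - 1) (x\<^sup>2 + 1)\<close> (\<open>fixed_point_poly_residue\<close>), so everything is decided in the residue field
  and transported back by Hensel's lemma (\<open>padic_Hensel\<close>).

  Every root is a p-adic integer, and it is congruent either to 1 or to a square root of -1
  (\<open>fixed_point_poly_root_residue\<close>). As p is odd, these residues are pairwise distinct simple
  zeros. Hence there is exactly one root congruent to 1. A square root of -1 exists modulo p
  exactly if p is 1 modulo 4 (\<open>padic_sqrt_minus_one_residue_iff\<close>): otherwise all roots are congruent
  to 1, so that there is only one; if p is 1 modulo 4, both square roots lift and, with the first
  root, exhaust the zeros of a cubic. The last claim, that the other roots are not
  congruent to 1, is the uniqueness of the first.

  Hensel's lemma is an instance of Banach's fixed point theorem. It requires the completeness of
  the p-adic numbers, which are given as classes of Cauchy sequences; for this they are made a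
  metric space in which the rationals are dense.
\<close>

section \<open>The absolute value of p-adic numbers\<close>

lemma padic_representative:
  fixes x :: "'p::prime_card padic"
  obtains X where "x = abs_padic X"
  by (induction x rule: padic.abs_induct) blast

text \<open>
  Multiplicativity and the ultrametric inequality pass from the rationals to the p-adic numbers
  through this limit, because they hold termwise along representing sequences.
\<close>

lemma padic_norm_tendsto:
  fixes X :: "'p::prime_card padic_seq"
  shows "(\<lambda>n. padic_abs CARD('p) (seq_of X n)) \<longlonglongrightarrow> padic_norm (abs_padic X)"
proof -
  have "convergent (\<lambda>n. padic_abs CARD('p) (seq_of X n))"
    using seq_of[of X] by (intro padic_Cauchy_abs prime_card) simp
  thus ?thesis
    by (simp add: padic_norm.abs_eq norm_seq.rep_eq convergent_LIMSEQ_iff)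
qed

lemma padic_norm_0 [simp]: "padic_norm (0 :: 'p::prime_card padic) = 0"
  using padic_norm_of_nat[where 'p = 'p, of 0] by simp

lemma padic_norm_1 [simp]: "padic_norm (1 :: 'p::prime_card padic) = 1"
  using padic_norm_of_nat[where 'p = 'p, of 1] by (simp add: padic_abs_1 prime_card)

lemma padic_norm_nonneg [simp]: "padic_norm (x :: 'p::prime_card padic) \<ge> 0"
proof -
  obtain X where x: "x = abs_padic X" by (rule padic_representative)
  show ?thesis unfolding x
    by (rule tendsto_lowerbound[OF padic_norm_tendsto]) (auto simp: padic_abs_nonneg)
qed

lemma padic_norm_mult: "padic_norm (x * y) = padic_norm x * padic_norm y"
  for x y :: "'p::prime_card padic"
proof -
  obtain X Y where x: "x = abs_padic X" and y: "y = abs_padic Y"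
    by (metis padic_representative)
  have "(\<lambda>n. padic_abs CARD('p) (seq_of (X * Y) n)) \<longlonglongrightarrow> padic_norm x * padic_norm y"
    unfolding x y times_padic_seq.rep_eq padic_abs_mult[OF prime_card]
    by (intro tendsto_mult padic_norm_tendsto)
  moreover have "(\<lambda>n. padic_abs CARD('p) (seq_of (X * Y) n)) \<longlonglongrightarrow> padic_norm (x * y)"
    unfolding x y times_padic.abs_eq by (rule padic_norm_tendsto)
  ultimately show ?thesis using LIMSEQ_unique by blast
qed

lemma padic_norm_minus [simp]: "padic_norm (- x) = padic_norm x"
  for x :: "'p::prime_card padic"
proof -
  obtain X where x: "x = abs_padic X" by (rule padic_representative)
  have "(\<lambda>n. padic_abs CARD('p) (seq_of (- X) n)) \<longlonglongrightarrow> padic_norm x"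
    unfolding x uminus_padic_seq.rep_eq padic_abs_minus by (rule padic_norm_tendsto)
  moreover have "(\<lambda>n. padic_abs CARD('p) (seq_of (- X) n)) \<longlonglongrightarrow> padic_norm (- x)"
    unfolding x uminus_padic.abs_eq by (rule padic_norm_tendsto)
  ultimately show ?thesis using LIMSEQ_unique by blast
qed

lemma padic_norm_minus_commute: "padic_norm (x - y) = padic_norm (y - x)"
  for x y :: "'p::prime_card padic"
  using padic_norm_minus[of "y - x"] by simp

lemma padic_norm_ultrametric: "padic_norm (x + y) \<le> max (padic_norm x) (padic_norm y)"
  for x y :: "'p::prime_card padic"
proof -
  obtain X Y where x: "x = abs_padic X" and y: "y = abs_padic Y"
    by (metis padic_representative)
  have "padic_norm (abs_padic (X + Y)) \<le> max (padic_norm x) (padic_norm y)"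
  proof (rule LIMSEQ_le)
    show "(\<lambda>n. padic_abs CARD('p) (seq_of (X + Y) n)) \<longlonglongrightarrow> padic_norm (abs_padic (X + Y))"
      by (rule padic_norm_tendsto)
    show "(\<lambda>n. max (padic_abs CARD('p) (seq_of X n)) (padic_abs CARD('p) (seq_of Y n)))
        \<longlonglongrightarrow> max (padic_norm x) (padic_norm y)"
      unfolding x y by (intro tendsto_max padic_norm_tendsto)
    show "\<exists>N. \<forall>n\<ge>N. padic_abs CARD('p) (seq_of (X + Y) n)
        \<le> max (padic_abs CARD('p) (seq_of X n)) (padic_abs CARD('p) (seq_of Y n))"
      unfolding plus_padic_seq.rep_eq by (intro exI allI impI padic_abs_add prime_card)
  qed
  thus ?thesis by (simp add: x y plus_padic.abs_eq)
qed

lemma padic_norm_eq_0_iff [simp]: "padic_norm x = 0 \<longleftrightarrow> x = 0"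
  for x :: "'p::prime_card padic"
proof
  assume 0: "padic_norm x = 0"
  show "x = 0"
  proof (rule ccontr)
    assume "x \<noteq> 0"
    hence "padic_norm x * padic_norm (inverse x) = 1"
      by (simp flip: padic_norm_mult)
    with 0 show False by simp
  qed
qed simp

lemma padic_norm_power: "padic_norm (x ^ n) = padic_norm x ^ n"
  for x :: "'p::prime_card padic"
  by (induction n) (simp_all add: padic_norm_mult)

lemma padic_norm_add_le:
  "padic_norm x \<le> c \<Longrightarrow> padic_norm y \<le> c \<Longrightarrow> padic_norm (x + y) \<le> c"
  for x y :: "'p::prime_card padic"
  using padic_norm_ultrametric[of x y] by simp

lemma padic_norm_add_less:
  "padic_norm x < c \<Longrightarrow> padic_norm y < c \<Longrightarrow> padic_norm (x + y) < c"
  for x y :: "'p::prime_card padic"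
  using padic_norm_ultrametric[of x y] by simp

lemma padic_norm_diff_le:
  "padic_norm x \<le> c \<Longrightarrow> padic_norm y \<le> c \<Longrightarrow> padic_norm (x - y) \<le> c"
  for x y :: "'p::prime_card padic"
  using padic_norm_add_le[of x c "- y"] by simp

lemma padic_norm_diff_less:
  "padic_norm x < c \<Longrightarrow> padic_norm y < c \<Longrightarrow> padic_norm (x - y) < c"
  for x y :: "'p::prime_card padic"
  using padic_norm_add_less[of x c "- y"] by simp

lemma padic_norm_mult_le_1:
  "padic_norm x \<le> 1 \<Longrightarrow> padic_norm y \<le> 1 \<Longrightarrow> padic_norm (x * y) \<le> 1"
  for x y :: "'p::prime_card padic"
  by (simp add: padic_norm_mult mult_le_one)

lemma padic_norm_mult_less_1:
  "padic_norm x \<le> 1 \<Longrightarrow> padic_norm y < 1 \<Longrightarrow> padic_norm (x * y) < 1"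
  for x y :: "'p::prime_card padic"
  using mult_right_mono[of "padic_norm x" 1 "padic_norm y"] by (simp add: padic_norm_mult)

text \<open>
  All triangles are isosceles. This is how absolute values are computed below: a number has the
  absolute value of anything that it is sufficiently close to.
\<close>

lemma padic_norm_dominant:
  fixes x y :: "'p::prime_card padic"
  assumes "padic_norm (x - y) < padic_norm y"
  shows "padic_norm x = padic_norm y"
  using assms padic_norm_ultrametric[of "x - y" y] padic_norm_ultrametric[of x "y - x"]
    padic_norm_minus_commute[of x y] by simp

lemma padic_norm_of_int:
  "padic_norm (of_int k :: 'p::prime_card padic) = padic_abs CARD('p) (of_int k)"
proof (cases k rule: int_cases2)
  case (nonneg n)
  thus ?thesis by (simp add: padic_norm_of_nat)
next
  case (nonpos n)
  thus ?thesis by (simp add: padic_norm_of_nat padic_abs_minus)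
qed

lemma padic_abs_of_int:
  assumes "prime p" "k \<noteq> 0"
  shows "padic_abs p (of_int k) = inverse (real p ^ multiplicity (int p) k)"
  using padic_abs_quotient[OF assms(1), of k 1] assms(2)
  by (simp add: power_int_minus)

lemma padic_norm_of_int_le_1 [simp]: "padic_norm (of_int k :: 'p::prime_card padic) \<le> 1"
proof (cases "k = 0")
  case False
  have "real CARD('p) \<ge> 1" using prime_ge_1_nat[OF prime_card[where 'a = 'p]] by linarith
  thus ?thesis
    unfolding padic_norm_of_int padic_abs_of_int[OF prime_card False]
    by (intro inverse_le_1_iff[THEN iffD2] disjI2 one_le_power)
qed simp

lemma padic_norm_of_nat_le_1 [simp]: "padic_norm (of_nat k :: 'p::prime_card padic) \<le> 1"
  using padic_norm_of_int_le_1[of "int k", where 'p = 'p] by simp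

lemma padic_norm_of_int_less_1_iff:
  "padic_norm (of_int k :: 'p::prime_card padic) < 1 \<longleftrightarrow> int CARD('p) dvd k"
proof (cases "k = 0")
  case False
  have p: "real CARD('p) > 1" using prime_gt_1_nat[OF prime_card[where 'a = 'p]] by linarith
  have "padic_norm (of_int k :: 'p padic) < 1 \<longleftrightarrow> multiplicity (int CARD('p)) k > 0"
    unfolding padic_norm_of_int padic_abs_of_int[OF prime_card False]
    using p by (cases "multiplicity (int CARD('p)) k")
      (auto simp: inverse_less_1_iff intro!: one_less_power simp del: power_Suc)
  also have "\<dots> \<longleftrightarrow> int CARD('p) dvd k"
    using False prime_card[where 'a = 'p]
    by (simp add: prime_multiplicity_gt_zero_iff)
  finally show ?thesis .
qed simp

section \<open>Completeness and density of the rationals\<close>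

instantiation padic :: (prime_card) metric_space
begin

definition dist_padic :: "'a padic \<Rightarrow> 'a padic \<Rightarrow> real" where
  "dist_padic x y = padic_norm (x - y)"

definition uniformity_padic :: "('a padic \<times> 'a padic) filter" where
  "uniformity_padic = (INF e\<in>{0 <..}. principal {(x, y). dist x y < e})"

definition open_padic :: "'a padic set \<Rightarrow> bool" where
  "open_padic U \<longleftrightarrow> (\<forall>x\<in>U. eventually (\<lambda>(x', y). x' = x \<longrightarrow> y \<in> U) uniformity)"

instance
proof
  fix x y z :: "'a padic"
  show "dist x y = 0 \<longleftrightarrow> x = y" by (simp add: dist_padic_def)
  show "dist x y \<le> dist x z + dist y z"
    using padic_norm_ultrametric[of "x - z" "z - y"] padic_norm_nonneg[of "x - z"]
      padic_norm_nonneg[of "z - y"] padic_norm_minus_commute[of y z]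
    unfolding dist_padic_def by (simp del: padic_norm_nonneg)
qed (simp_all add: uniformity_padic_def open_padic_def)

end

lift_definition const_seq :: "rat \<Rightarrow> 'p::prime_card padic_seq" is "\<lambda>q n. q" by simp

definition padic_of_rat :: "rat \<Rightarrow> 'p::prime_card padic" where
  "padic_of_rat q = abs_padic (const_seq q)"

text \<open>
  The distance is a limit over the terms of the representing sequence, so estimates between
  rationals that hold uniformly in the index pass to the limit.
\<close>

lemma dist_padic_of_rat:
  "dist (padic_of_rat q :: 'p::prime_card padic) (abs_padic X)
    = lim (\<lambda>n. padic_abs CARD('p) (q - seq_of X n))"
proof -
  have "(\<lambda>n. padic_abs CARD('p) (seq_of (const_seq q - X) n))
      \<longlonglongrightarrow> padic_norm (abs_padic (const_seq q - X))"
    by (rule padic_norm_tendsto)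
  moreover have "abs_padic (const_seq q - X) = padic_of_rat q - abs_padic X"
    unfolding diff_conv_add_uminus padic_of_rat_def
    by (simp add: plus_padic.abs_eq uminus_padic.abs_eq)
  ultimately show ?thesis
    by (simp add: dist_padic_def limI minus_padic_seq.rep_eq const_seq.rep_eq)
qed

lemma dist_padic_of_rat_of_rat:
  "dist (padic_of_rat q :: 'p::prime_card padic) (padic_of_rat r) = padic_abs CARD('p) (q - r)"
  unfolding padic_of_rat_def[of r] dist_padic_of_rat const_seq.rep_eq by simp

lemma padic_of_rat_tendsto:
  fixes X :: "'p::prime_card padic_seq"
  shows "(\<lambda>n. padic_of_rat (seq_of X n)) \<longlonglongrightarrow> abs_padic X"
  unfolding tendsto_iff
proof (intro allI impI)
  fix e :: real assume "e > 0"
  hence "e / 2 > 0" by simp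
  then obtain N where N: "\<And>m n. m \<ge> N \<Longrightarrow> n \<ge> N \<Longrightarrow>
      padic_abs CARD('p) (seq_of X m - seq_of X n) < e / 2"
    using seq_of[of X] unfolding mem_Collect_eq padic_Cauchy_def by blast
  have "dist (padic_of_rat (seq_of X m)) (abs_padic X) < e" if m: "m \<ge> N" for m
  proof -
    let ?Y = "const_seq (seq_of X m) - X"
    have "(\<lambda>n. padic_abs CARD('p) (seq_of ?Y n)) \<longlonglongrightarrow> padic_norm (abs_padic ?Y)"
      by (rule padic_norm_tendsto)
    hence lim: "(\<lambda>n. padic_abs CARD('p) (seq_of X m - seq_of X n))
        \<longlonglongrightarrow> dist (padic_of_rat (seq_of X m)) (abs_padic X)"
      unfolding dist_padic_of_rat by (simp add: limI minus_padic_seq.rep_eq const_seq.rep_eq)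
    have "dist (padic_of_rat (seq_of X m)) (abs_padic X) \<le> e / 2"
      using N[OF m] by (intro LIMSEQ_le_const2[OF lim] exI[of _ N]) (auto intro: less_imp_le)
    with \<open>e > 0\<close> show ?thesis by linarith
  qed
  thus "eventually (\<lambda>n. dist (padic_of_rat (seq_of X n)) (abs_padic X) < e) sequentially"
    by (auto simp: eventually_sequentially)
qed

lemma padic_of_rat_dense:
  fixes x :: "'p::prime_card padic"
  assumes "e > 0"
  obtains q where "dist (padic_of_rat q) x < e"
proof -
  obtain X where "x = abs_padic X" by (rule padic_representative)
  thus ?thesis
    using tendstoD[OF padic_of_rat_tendsto[of X] assms] that
    by (auto simp: eventually_sequentially)
qed

lemma Lim_transform_dist:
  assumes "(f \<longlongrightarrow> l) F" "((\<lambda>x. dist (f x) (g x)) \<longlongrightarrow> 0) F"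
  shows "(g \<longlongrightarrow> l) F"
  unfolding tendsto_dist_iff[of g]
proof (rule tendsto_sandwich[OF _ _ tendsto_const])
  show "((\<lambda>x. dist (f x) (g x) + dist (f x) l) \<longlongrightarrow> 0) F"
    using tendsto_add[OF assms(2)] assms(1) by (simp add: tendsto_dist_iff[of f])
  show "eventually (\<lambda>x. dist (g x) l \<le> dist (f x) (g x) + dist (f x) l) F"
    by (intro always_eventually allI dist_triangle3)
qed simp

text \<open>
  The usual diagonal argument: each term of the given sequence is replaced by a rational that
  is closer and closer to it. The rationals form a Cauchy sequence with respect to the rational
  absolute value, and its class is the limit.
\<close>

instance padic :: (prime_card) complete_space
proof
  fix X :: "nat \<Rightarrow> 'a padic"
  assume X: "Cauchy X"
  have "\<exists>q. dist (padic_of_rat q) (X n) < inverse (real (Suc n))" for n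
    by (rule padic_of_rat_dense[of "inverse (real (Suc n))" "X n"]) auto
  then obtain q where q: "\<And>n. dist (padic_of_rat (q n)) (X n) < inverse (real (Suc n))"
    by metis
  have qX: "(\<lambda>n. dist (padic_of_rat (q n)) (X n)) \<longlonglongrightarrow> 0"
    by (rule tendsto_sandwich[OF _ _ tendsto_const LIMSEQ_inverse_real_of_nat])
      (use q in \<open>auto intro!: always_eventually less_imp_le simp del: of_nat_Suc\<close>)
  have "padic_Cauchy CARD('a) q"
    unfolding padic_Cauchy_def
  proof (intro allI impI)
    fix e :: real assume "e > 0"
    hence e: "e / 3 > 0" by simp
    obtain M where M: "\<And>m n. m \<ge> M \<Longrightarrow> n \<ge> M \<Longrightarrow> dist (X m) (X n) < e / 3"
      using X e unfolding Cauchy_def by blast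
    obtain N where N: "\<And>n. n \<ge> N \<Longrightarrow> dist (padic_of_rat (q n)) (X n) < e / 3"
      using order_tendstoD(2)[OF qX e] by (auto simp: eventually_sequentially)
    have "padic_abs CARD('a) (q m - q n) < e" if "m \<ge> max M N" "n \<ge> max M N" for m n
      unfolding dist_padic_of_rat_of_rat[symmetric, where 'p = 'a]
      using M[of m n] N[of m] N[of n] that
        dist_triangle[of "padic_of_rat (q m)" "padic_of_rat (q n)" "X m"]
        dist_triangle[of "X m" "padic_of_rat (q n)" "X n"]
      by (simp add: dist_commute)
    thus "\<exists>N. \<forall>m\<ge>N. \<forall>n\<ge>N. padic_abs CARD('a) (q m - q n) < e" by blast
  qed
  hence "(\<lambda>n. padic_of_rat (q n)) \<longlonglongrightarrow> (abs_padic (Padic_seq q) :: 'a padic)"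
    using padic_of_rat_tendsto[of "Padic_seq q :: 'a padic_seq"] by (simp add: Padic_seq_inverse)
  hence "X \<longlonglongrightarrow> abs_padic (Padic_seq q)"
    using qX by (rule Lim_transform_dist)
  thus "convergent X" by (rule convergentI)
qed

lemma padic_of_rat_mult: "padic_of_rat (q * r) = padic_of_rat q * padic_of_rat r"
  unfolding padic_of_rat_def times_padic.abs_eq
  by (rule arg_cong[of _ _ abs_padic]) (transfer, simp)

lemma padic_of_rat_of_int: "padic_of_rat (of_int k) = (of_int k :: 'p::prime_card padic)"
proof -
  have *: "padic_of_rat (of_nat n) = (of_nat n :: 'p padic)" for n
    unfolding of_nat_padic padic_of_rat_def
    by (rule arg_cong[of _ _ abs_padic])
      (simp add: seq_of_inject[symmetric] const_seq.rep_eq of_nat_padic_seq)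
  have "padic_of_rat (- q) = (- padic_of_rat q :: 'p padic)" for q
    unfolding padic_of_rat_def uminus_padic.abs_eq
    by (rule arg_cong[of _ _ abs_padic]) (transfer, simp)
  with * show ?thesis by (cases k rule: int_cases2) simp_all
qed

text \<open>
  The residue field has p elements, all of them represented by integers. By density it suffices
  to treat a rational \<open>n / d\<close> in lowest terms; as its absolute value is at most 1, p does not divide
  \<open>d\<close>, and \<open>n e\<close> is the wanted integer for an inverse \<open>e\<close> of \<open>d\<close> modulo p.
\<close>

lemma padic_residue_int:
  fixes x :: "'p::prime_card padic"
  assumes "padic_norm x \<le> 1"
  obtains k :: int where "padic_norm (x - of_int k) < 1"
proof -
  let ?p = "int CARD('p)"
  obtain q where q: "dist (padic_of_rat q) x < 1"
    using padic_of_rat_dense[of 1 x] by auto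
  obtain n d where nd: "quotient_of q = (n, d)" by (cases "quotient_of q")
  have d: "d > 0" and cop: "coprime n d" and qnd: "q = of_int n / of_int d"
    using nd by (auto intro: quotient_of_denom_pos quotient_of_coprime quotient_of_div)
  define y :: "'p padic" where "y = padic_of_rat q"
  have xy: "padic_norm (x - y) < 1"
    using q by (simp add: y_def dist_padic_def padic_norm_minus_commute)
  have y1: "padic_norm y \<le> 1"
    using padic_norm_diff_le[of x 1 "x - y"] xy assms by simp
  have "q * of_int d = of_int n" using d by (simp add: qnd)
  from arg_cong[OF this, of padic_of_rat]
  have yd: "y * of_int d = of_int n"
    by (simp add: padic_of_rat_mult padic_of_rat_of_int y_def)
  have nd: "\<not> ?p dvd d"
  proof
    assume dvd: "?p dvd d"
    hence "padic_norm (y * of_int d) < 1"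
      using y1 by (intro padic_norm_mult_less_1) (simp_all add: padic_norm_of_int_less_1_iff)
    hence "?p dvd n" by (simp add: yd padic_norm_of_int_less_1_iff)
    with dvd cop have "is_unit ?p" by (meson coprime_common_divisor)
    thus False using prime_gt_1_nat[OF prime_card[where 'a = 'p]] by simp
  qed
  have "coprime d ?p"
    using nd prime_card[where 'a = 'p] by (metis coprime_commute prime_imp_coprime prime_nat_int_transfer)
  then obtain e where "[d * e = 1] (mod ?p)" using cong_solve_coprime_int by blast
  hence "?p dvd 1 - d * e" by (metis cong_iff_dvd_diff cong_sym)
  hence "padic_norm (of_int (1 - d * e) :: 'p padic) < 1" by (simp only: padic_norm_of_int_less_1_iff)
  from padic_norm_mult_less_1[OF y1 this]
  have "padic_norm (y - of_int (n * e)) < 1"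
    by (simp add: algebra_simps flip: yd)
  from padic_norm_add_less[OF xy this] show ?thesis
    by (intro that[of "n * e"]) simp
qed

section \<open>Hensel's lemma\<close>

lemma padic_norm_poly_le_1:
  fixes f :: "'p::prime_card padic poly"
  assumes "\<And>i. padic_norm (coeff f i) \<le> 1" "padic_norm x \<le> 1"
  shows "padic_norm (poly f x) \<le> 1"
  using assms(1)
proof (induction f)
  case (pCons c f)
  have "padic_norm (coeff f i) \<le> 1" for i using pCons.prems[of "Suc i"] by simp
  hence "padic_norm (poly f x) \<le> 1" by (rule pCons.IH)
  thus ?case
    using pCons.prems[of 0] assms(2)
    by (auto intro!: padic_norm_add_le padic_norm_mult_le_1)
qed simp

lemma padic_norm_pderiv_le_1:
  fixes f :: "'p::prime_card padic poly"
  assumes "\<And>i. padic_norm (coeff f i) \<le> 1" "padic_norm x \<le> 1"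
  shows "padic_norm (poly (pderiv f) x) \<le> 1"
proof (rule padic_norm_poly_le_1)
  show "padic_norm (coeff (pderiv f) i) \<le> 1" for i
    unfolding coeff_pderiv by (intro padic_norm_mult_le_1 padic_norm_of_nat_le_1 assms)
qed fact

text \<open>
  Induction along Horner's scheme, splitting
  \<open>x f(x) - y f(y) = x (f(x) - f(y)) + (x - y) f(y)\<close>.
\<close>

lemma padic_poly_lipschitz:
  fixes f :: "'p::prime_card padic poly"
  assumes "\<And>i. padic_norm (coeff f i) \<le> 1" and x: "padic_norm x \<le> 1" and y: "padic_norm y \<le> 1"
  shows "padic_norm (poly f x - poly f y) \<le> padic_norm (x - y)"
  using assms(1)
proof (induction f)
  case (pCons a f)
  have int: "padic_norm (coeff f i) \<le> 1" for i using pCons.prems[of "Suc i"] by simp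
  have "padic_norm (x * (poly f x - poly f y)) \<le> 1 * padic_norm (x - y)"
    unfolding padic_norm_mult by (intro mult_mono x pCons.IH int) auto
  moreover have "padic_norm ((x - y) * poly f y) \<le> padic_norm (x - y) * 1"
    unfolding padic_norm_mult by (intro mult_left_mono padic_norm_poly_le_1 int y) auto
  ultimately have
    "padic_norm (x * (poly f x - poly f y) + (x - y) * poly f y) \<le> padic_norm (x - y)"
    by (intro padic_norm_add_le) auto
  thus ?case by (simp add: algebra_simps)
qed simp

text \<open>
  Near \<open>r\<close> a polynomial with integral coefficients is linear with slope \<open>f'(r)\<close> up to a relative error
  \<open>c\<close>. Both halves of Hensel's lemma rest on this: the error makes the Newton map a contraction, and
  two roots in the same residue class would have a difference smaller than itself.
\<close>

lemma padic_poly_linear_approx: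
  fixes f :: "'p::prime_card padic poly"
  assumes "\<And>i. padic_norm (coeff f i) \<le> 1" and r: "padic_norm r \<le> 1" and c: "c \<le> 1"
    and x: "padic_norm (x - r) \<le> c" and y: "padic_norm (y - r) \<le> c"
  shows "padic_norm (poly f x - poly f y - (x - y) * poly (pderiv f) r) \<le> c * padic_norm (x - y)"
  using assms(1)
proof (induction f)
  case 0
  have "0 \<le> c" using x padic_norm_nonneg order_trans by blast
  thus ?case by simp
next
  case (pCons a f)
  have int: "padic_norm (coeff f i) \<le> 1" for i using pCons.prems[of "Suc i"] by simp
  have c0: "0 \<le> c" using x padic_norm_nonneg order_trans by blast
  have x1: "padic_norm x \<le> 1" using padic_norm_add_le[of "x - r" 1 r] x r c by simp
  have y1: "padic_norm y \<le> 1" using padic_norm_add_le[of "y - r" 1 r] y r c by simp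
  have "padic_norm (x * (poly f x - poly f y - (x - y) * poly (pderiv f) r))
      \<le> 1 * (c * padic_norm (x - y))"
    unfolding padic_norm_mult[of x] by (intro mult_mono x1 pCons.IH int) auto
  moreover have "padic_norm (((x - r) * poly (pderiv f) r) * (x - y)) \<le> (c * 1) * padic_norm (x - y)"
    unfolding padic_norm_mult
    by (intro mult_right_mono mult_mono x padic_norm_pderiv_le_1 int r c0) auto
  moreover have "padic_norm (poly f y - poly f r) \<le> c"
    using padic_poly_lipschitz[OF int y1 r] y by linarith
  hence "padic_norm ((poly f y - poly f r) * (x - y)) \<le> c * padic_norm (x - y)"
    unfolding padic_norm_mult by (intro mult_right_mono) auto
  \<comment> \<open>The sum of the three terms is the error for the polynomial \<open>a + x f(x)\<close>.\<close>
  ultimately have "padic_norm (x * (poly f x - poly f y - (x - y) * poly (pderiv f) r)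
      + ((x - r) * poly (pderiv f) r) * (x - y) + (poly f y - poly f r) * (x - y))
      \<le> c * padic_norm (x - y)"
    by (intro padic_norm_add_le) auto
  thus ?case by (simp add: pderiv_pCons algebra_simps)
qed

text \<open>
  Existence is Banach's fixed point theorem for the Newton map with the derivative frozen at the
  starting point, \<open>x - f(x) / f'(r)\<close>. On the closed ball of radius \<open>c = |f(r)| < 1\<close> around \<open>r\<close> it is a
  contraction with factor \<open>c\<close>, and the ball is preserved because \<open>r\<close> itself is moved by exactly \<open>c\<close>.
\<close>

theorem padic_Hensel:
  fixes f :: "'p::prime_card padic poly"
  assumes int: "\<And>i. padic_norm (coeff f i) \<le> 1" and r: "padic_norm r \<le> 1"
    and root: "padic_norm (poly f r) < 1" and simple: "padic_norm (poly (pderiv f) r) = 1"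
  shows "\<exists>!x. poly f x = 0 \<and> padic_norm (x - r) < 1"
proof (rule ex_ex1I)
  define d where "d = poly (pderiv f) r"
  define c where "c = padic_norm (poly f r)"
  define T where "T x = x - poly f x / d" for x
  have d: "padic_norm d = 1" "d \<noteq> 0" using simple by (auto simp: d_def)
  have c: "0 \<le> c" "c < 1" "c \<le> 1" using root by (auto simp: c_def)
  have div_d: "padic_norm (z / d) = padic_norm z" for z
    using d padic_norm_mult[of "z / d" d] by simp
  have contr: "dist (T x) (T y) \<le> c * dist x y"
    if "x \<in> cball r c" "y \<in> cball r c" for x y
  proof -
    have "T x - T y = - ((poly f x - poly f y - (x - y) * d) / d)"
      using d by (simp add: T_def field_simps)
    hence "dist (T x) (T y) = padic_norm (poly f x - poly f y - (x - y) * d)"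
      by (simp add: dist_padic_def div_d)
    also have "\<dots> \<le> c * padic_norm (x - y)"
      unfolding d_def using that
      by (intro padic_poly_linear_approx int r c)
        (simp_all add: dist_padic_def padic_norm_minus_commute)
    finally show ?thesis by (simp add: dist_padic_def)
  qed
  have "T ` cball r c \<subseteq> cball r c"
  proof
    fix z assume "z \<in> T ` cball r c"
    then obtain x where x: "x \<in> cball r c" and z: "z = T x" by blast
    have "dist (T x) (T r) \<le> c * dist x r" using c x by (intro contr) auto
    also have "\<dots> \<le> 1 * c" using x c by (intro mult_mono) (auto simp: dist_commute)
    finally have "padic_norm (T x - T r) \<le> c" by (simp add: dist_padic_def)
    moreover have "padic_norm (T r - r) \<le> c" by (simp add: T_def div_d c_def)
    ultimately have "padic_norm (T x - T r + (T r - r)) \<le> c" by (rule padic_norm_add_le)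
    thus "z \<in> cball r c" by (simp add: z dist_padic_def padic_norm_minus_commute)
  qed
  moreover have "complete (cball r c)" "cball r c \<noteq> {}"
    using c by (simp_all add: complete_eq_closed)
  ultimately obtain x where x: "x \<in> cball r c" "T x = x"
    using Banach_fix[of "cball r c" c T] contr c by blast
  thus "\<exists>x. poly f x = 0 \<and> padic_norm (x - r) < 1"
    using c d by (intro exI[of _ x]) (auto simp: T_def dist_padic_def padic_norm_minus_commute)
next
  fix x y
  assume x: "poly f x = 0 \<and> padic_norm (x - r) < 1" and y: "poly f y = 0 \<and> padic_norm (y - r) < 1"
  define c where "c = max (padic_norm (x - r)) (padic_norm (y - r))"
  have "padic_norm (poly f x - poly f y - (x - y) * poly (pderiv f) r) \<le> c * padic_norm (x - y)"
    using x y by (intro padic_poly_linear_approx int r) (auto simp: c_def)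
  also have "poly f x - poly f y - (x - y) * poly (pderiv f) r = - ((x - y) * poly (pderiv f) r)"
    using x y by simp
  finally have "(1 - c) * padic_norm (x - y) \<le> 0"
    unfolding padic_norm_minus padic_norm_mult simple by (simp add: left_diff_distrib)
  moreover have "c < 1" using x y by (simp add: c_def)
  ultimately have "padic_norm (x - y) = 0"
    using padic_norm_nonneg[of "x - y"] by (simp add: mult_le_0_iff)
  thus "x = y" by simp
qed

section \<open>Square roots of minus one modulo a prime\<close>

text \<open>
  By Euler's criterion the Legendre symbol of -1 is the sign \<open>(-1)\<^bsup>(p-1)/2\<^esup>\<close>.
\<close>

lemma QuadRes_minus_one_iff:
  assumes p: "prime p" "p \<noteq> 2"
  shows "QuadRes (int p) (-1) \<longleftrightarrow> [p = 1] (mod 4)"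
proof -
  have p2: "p > 2" using p prime_ge_2_nat[of p] by linarith
  have "odd p" using p prime_odd_nat p2 by blast
  have n1: "\<not> [- 1 = 0] (mod int p)" "\<not> [1 = - 1] (mod int p)" 
    using p2 zdvd_imp_le[of "int p" 2] by (auto simp: cong_iff_dvd_diff)
  have euler: "[Legendre (- 1) (int p) = (- 1) ^ ((p - 1) div 2)] (mod int p)"
    using euler_criterion[OF p(1) p2] .
  have "QuadRes (int p) (-1) \<longleftrightarrow> even ((p - 1) div 2)"
    using euler n1 by (cases "even ((p - 1) div 2)") (auto simp: Legendre_def cong_sym_eq split: if_splits)
  also have "\<dots> \<longleftrightarrow> [p = 1] (mod 4)"
    using \<open>odd p\<close> unfolding cong_def by presburger
  finally show ?thesis .
qed

section \<open>The fixed points as roots of a cubic\<close>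

definition fixed_point_poly :: "'p::prime_card padic \<Rightarrow> 'p padic \<Rightarrow> 'p padic poly" where
  "fixed_point_poly a b = [:- a, b\<^sup>2, - (a * b\<^sup>2), 1:]"

lemma poly_fixed_point_poly:
  "poly (fixed_point_poly a b) x = x * (b\<^sup>2 + x\<^sup>2) - a * (b\<^sup>2 * x\<^sup>2 + 1)"
  by (simp add: fixed_point_poly_def algebra_simps power2_eq_square)

lemma E_padic_norm:
  assumes "(x :: 'p::prime_card padic) \<in> E_padic"
  shows "padic_norm x = 1"
  using assms padic_norm_dominant[of x 1] by (simp add: E_padic_def)

lemma E_padic_square:
  assumes "(x :: 'p::prime_card padic) \<in> E_padic"
  shows "x\<^sup>2 \<in> E_padic"
proof -
  have "padic_norm ((x + 1) * (x - 1)) < 1"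
    using assms E_padic_norm[OF assms]
    by (intro padic_norm_mult_less_1 padic_norm_add_le) (auto simp: E_padic_def)
  thus ?thesis by (simp add: E_padic_def algebra_simps power2_eq_square)
qed

lemma padic_norm_2:
  assumes "CARD('p::prime_card) \<ge> 3"
  shows "padic_norm (2 :: 'p padic) = 1"
proof -
  have "\<not> int CARD('p) dvd 2" using assms zdvd_imp_le[of "int CARD('p)" 2] by auto
  hence "\<not> padic_norm (of_int 2 :: 'p padic) < 1"
    by (simp only: padic_norm_of_int_less_1_iff not_False_eq_True)
  thus ?thesis using padic_norm_of_int_le_1[of 2, where 'p = 'p] by simp
qed

text \<open>
  Clearing denominators could only add roots at which \<open>b\<^sup>2 + x\<^sup>2 = 0\<close>. There the cubic takes the value
  \<open>- a (1 - b\<^sup>4)\<close>, and \<open>1 - b\<^sup>4\<close> factors into \<open>1 - b\<close>, which is nonzero by hypothesis, and two numbers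
  congruent to 2.
\<close>

lemma fixed_points_eq_roots:
  fixes a b :: "'p::prime_card padic"
  assumes p: "CARD('p) \<ge> 3" and a: "a \<in> E_padic" and b: "b \<in> E_padic" and b1: "b \<noteq> 1"
  shows "fixed_points a b = {x. poly (fixed_point_poly a b) x = 0}"
proof -
  have iff: "g_map a b x = x \<longleftrightarrow> poly (fixed_point_poly a b) x = 0" if "b\<^sup>2 + x\<^sup>2 \<noteq> 0" for x
    using that by (auto simp: g_map_def poly_fixed_point_poly field_simps)
  have nz: "x + 1 \<noteq> 0" if "x \<in> E_padic" for x :: "'p padic"
  proof -
    have "padic_norm (x + 1) = padic_norm (2 :: 'p padic)"
      using that padic_norm_2[OF p] by (intro padic_norm_dominant) (simp add: E_padic_def)
    thus ?thesis using padic_norm_2[OF p] by auto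
  qed
  have "b\<^sup>2 + x\<^sup>2 \<noteq> 0" if "poly (fixed_point_poly a b) x = 0" for x
  proof
    assume 0: "b\<^sup>2 + x\<^sup>2 = 0"
    hence x: "x\<^sup>2 = - b\<^sup>2" by (simp add: eq_neg_iff_add_eq_0 add.commute)
    have "a * (1 - b\<^sup>2 * b\<^sup>2) = 0" using that by (simp add: poly_fixed_point_poly x)
    also have "1 - b\<^sup>2 * b\<^sup>2 = - ((b - 1) * (b + 1) * (b\<^sup>2 + 1))"
      by (simp add: algebra_simps power2_eq_square)
    finally show False
      using b1 nz[OF b] nz[OF E_padic_square[OF b]] E_padic_norm[OF a] by auto
  qed
  with iff show ?thesis by (auto simp: fixed_points_def)
qed

lemma coeff_fixed_point_poly_le_1:
  fixes a b :: "'p::prime_card padic"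
  assumes "a \<in> E_padic" "b \<in> E_padic"
  shows "padic_norm (coeff (fixed_point_poly a b) i) \<le> 1"
  using E_padic_norm[OF assms(1)] E_padic_norm[OF assms(2)]
  by (auto simp: fixed_point_poly_def coeff_pCons padic_norm_mult padic_norm_power split: nat.split)

text \<open>
  The coefficients are congruent to those of \<open>(x - 1) (x\<^sup>2 + 1) = x\<^sup>3 - x\<^sup>2 + x - 1\<close>.
\<close>

lemma fixed_point_poly_residue:
  fixes a b x :: "'p::prime_card padic"
  assumes a: "a \<in> E_padic" and b: "b \<in> E_padic" and x: "padic_norm x \<le> 1"
  shows "padic_norm (poly (fixed_point_poly a b) x - (x - 1) * (x\<^sup>2 + 1)) < 1"
    and "padic_norm (poly (pderiv (fixed_point_poly a b)) x - (3 * x\<^sup>2 - 2 * x + 1)) < 1"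
proof -
  have a1: "padic_norm (a - 1) < 1" and b1: "padic_norm (b\<^sup>2 - 1) < 1"
    using a E_padic_square[OF b] by (simp_all add: E_padic_def)
  have "padic_norm (a * (b\<^sup>2 - 1) + (a - 1)) < 1"
    using E_padic_norm[OF a] by (intro padic_norm_add_less padic_norm_mult_less_1 a1 b1) simp
  hence ab: "padic_norm (a * b\<^sup>2 - 1) < 1" by (simp add: algebra_simps)
  have "padic_norm (x * (b\<^sup>2 - 1) - (x * x) * (a * b\<^sup>2 - 1) - (a - 1)) < 1"
    by (intro padic_norm_diff_less padic_norm_mult_less_1 padic_norm_mult_le_1 x a1 b1 ab)
  thus "padic_norm (poly (fixed_point_poly a b) x - (x - 1) * (x\<^sup>2 + 1)) < 1"
    by (simp add: poly_fixed_point_poly algebra_simps power2_eq_square)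
  have "padic_norm ((b\<^sup>2 - 1) - (of_nat 2 * x) * (a * b\<^sup>2 - 1)) < 1"
    by (intro padic_norm_diff_less padic_norm_mult_less_1 padic_norm_mult_le_1 x a1 b1 ab
        padic_norm_of_nat_le_1)
  thus "padic_norm (poly (pderiv (fixed_point_poly a b)) x - (3 * x\<^sup>2 - 2 * x + 1)) < 1"
    by (simp add: fixed_point_poly_def pderiv_pCons algebra_simps power2_eq_square)
qed

text \<open>
  Roots are integral because the cubic is monic: for \<open>|x| > 1\<close> the term \<open>x\<^sup>3\<close> would be larger than all
  the others. Modulo p a root is then a zero of \<open>(x - 1) (x\<^sup>2 + 1)\<close>, and the absolute value is
  multiplicative.
\<close>

lemma fixed_point_poly_root_residue:
  fixes a b x :: "'p::prime_card padic"
  assumes a: "a \<in> E_padic" and b: "b \<in> E_padic" and root: "poly (fixed_point_poly a b) x = 0"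
  shows "padic_norm x \<le> 1" and "x \<in> E_padic \<or> padic_norm (x\<^sup>2 + 1) < 1"
proof -
  note ab = E_padic_norm[OF a] E_padic_norm[OF b]
  show x1: "padic_norm x \<le> 1"
  proof (rule ccontr)
    assume "\<not> padic_norm x \<le> 1"
    hence x: "padic_norm x > 1" by simp
    have "x ^ 3 = (a * b\<^sup>2) * x\<^sup>2 - b\<^sup>2 * x + a"
      using root by (simp add: poly_fixed_point_poly algebra_simps power2_eq_square power3_eq_cube)
    moreover have "padic_norm ((a * b\<^sup>2) * x\<^sup>2 - b\<^sup>2 * x + a) \<le> padic_norm x ^ 2"
      using x ab by (intro padic_norm_add_le padic_norm_diff_le)
        (simp_all add: padic_norm_mult padic_norm_power self_le_power)
    ultimately have "padic_norm x ^ 3 \<le> padic_norm x ^ 2"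
      by (simp flip: padic_norm_power)
    thus False using x power_strict_increasing[of 2 3 "padic_norm x"] by simp
  qed
  have "padic_norm ((x - 1) * (x\<^sup>2 + 1)) < 1"
    using fixed_point_poly_residue(1)[OF a b x1] root by (simp add: padic_norm_minus_commute)
  hence "\<not> (padic_norm (x - 1) \<ge> 1 \<and> padic_norm (x\<^sup>2 + 1) \<ge> 1)"
    using mult_mono[of 1 "padic_norm (x - 1)" 1 "padic_norm (x\<^sup>2 + 1)"]
    by (auto simp: padic_norm_mult)
  thus "x \<in> E_padic \<or> padic_norm (x\<^sup>2 + 1) < 1"
    by (auto simp: E_padic_def)
qed

text \<open>The derivative of \<open>(x - 1) (x\<^sup>2 + 1)\<close> at 1 is 2, a unit.\<close>

lemma ex1_fixed_point_poly_root_E_padic: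
  fixes a b :: "'p::prime_card padic"
  assumes p: "CARD('p) \<ge> 3" and a: "a \<in> E_padic" and b: "b \<in> E_padic"
  shows "\<exists>!x. poly (fixed_point_poly a b) x = 0 \<and> x \<in> E_padic"
  unfolding E_padic_def mem_Collect_eq
proof (rule padic_Hensel)
  show "padic_norm (poly (fixed_point_poly a b) 1) < 1"
    using fixed_point_poly_residue(1)[OF a b, of 1] by simp
  have "padic_norm (poly (pderiv (fixed_point_poly a b)) 1) = padic_norm (2 :: 'p padic)"
    using fixed_point_poly_residue(2)[OF a b, of 1] padic_norm_2[OF p]
    by (intro padic_norm_dominant) simp
  thus "padic_norm (poly (pderiv (fixed_point_poly a b)) 1) = 1"
    using padic_norm_2[OF p] by simp
qed (simp_all add: coeff_fixed_point_poly_le_1 a b)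

text \<open>
  A square root of -1 modulo p is a unit and differs from both 1 and -1 modulo p: its square is
  congruent to -1, and \<open>(r - 1) (r + 1)\<close> is congruent to the unit -2. A factor of a unit that is
  integral with integral cofactor is a unit itself.
\<close>

lemma padic_norm_sqrt_minus_one:
  fixes r :: "'p::prime_card padic"
  assumes p: "CARD('p) \<ge> 3" and r: "padic_norm r \<le> 1" and r2: "padic_norm (r\<^sup>2 + 1) < 1"
  shows "padic_norm r = 1" "padic_norm (r - 1) = 1" "padic_norm (r + 1) = 1"
proof -
  have factor: "padic_norm u = 1"
    if "padic_norm u \<le> 1" "padic_norm v \<le> 1" "padic_norm (u * v) = 1" for u v :: "'p padic"
    using that mult_left_mono[of "padic_norm v" 1 "padic_norm u"] by (simp add: padic_norm_mult)
  have le: "padic_norm (r - 1) \<le> 1" "padic_norm (r + 1) \<le> 1"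
    by (intro padic_norm_diff_le padic_norm_add_le r; simp)+
  have "padic_norm ((r - 1) * (r + 1)) = padic_norm (- 2 :: 'p padic)"
    using r2 padic_norm_2[OF p]
    by (intro padic_norm_dominant) (simp add: algebra_simps power2_eq_square)
  hence 1: "padic_norm ((r - 1) * (r + 1)) = 1" using padic_norm_2[OF p] by simp
  show "padic_norm (r - 1) = 1" by (rule factor[OF le 1])
  show "padic_norm (r + 1) = 1" using 1 by (intro factor[OF le(2,1)]) (simp add: mult.commute)
  have "padic_norm (r * r) = padic_norm (- 1 :: 'p padic)"
    using r2 by (intro padic_norm_dominant) (simp add: power2_eq_square)
  thus "padic_norm r = 1" by (intro factor[of r r] r) simp
qed

text \<open>
  The zero \<open>r\<close> is simple because \<open>3 r\<^sup>2 - 2 r + 1 = 3 (r\<^sup>2 + 1) - 2 (r + 1)\<close> is congruent to the unit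
  \<open>- 2 (r + 1)\<close>.
\<close>

lemma fixed_point_poly_root_near_sqrt_minus_one:
  fixes a b r :: "'p::prime_card padic"
  assumes p: "CARD('p) \<ge> 3" and a: "a \<in> E_padic" and b: "b \<in> E_padic"
    and r: "padic_norm r \<le> 1" and r2: "padic_norm (r\<^sup>2 + 1) < 1"
  obtains x where "poly (fixed_point_poly a b) x = 0" "padic_norm (x - r) < 1"
proof -
  have "\<exists>!x. poly (fixed_point_poly a b) x = 0 \<and> padic_norm (x - r) < 1"
  proof (rule padic_Hensel)
    have "padic_norm ((r - 1) * (r\<^sup>2 + 1)) < 1"
      using padic_norm_sqrt_minus_one(2)[OF p r r2] r2 by (intro padic_norm_mult_less_1) auto
    from padic_norm_add_less[OF fixed_point_poly_residue(1)[OF a b r] this]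
    show "padic_norm (poly (fixed_point_poly a b) r) < 1" by simp
    have "padic_norm (of_nat 3 * (r\<^sup>2 + 1)) < 1"
      by (intro padic_norm_mult_less_1 r2 padic_norm_of_nat_le_1)
    from padic_norm_add_less[OF fixed_point_poly_residue(2)[OF a b r] this]
    have "padic_norm (poly (pderiv (fixed_point_poly a b)) r - - (2 * (r + 1))) < 1"
      by (simp add: algebra_simps)
    moreover have "padic_norm (- (2 * (r + 1))) = 1"
      unfolding padic_norm_minus padic_norm_mult
      by (simp only: padic_norm_2[OF p] padic_norm_sqrt_minus_one(3)[OF p r r2] mult_1)
    ultimately show "padic_norm (poly (pderiv (fixed_point_poly a b)) r) = 1"
      by (metis padic_norm_dominant)
  qed (simp_all add: coeff_fixed_point_poly_le_1 a b r)
  thus ?thesis using that by blast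
qed

lemma padic_sqrt_minus_one_residue_iff:
  assumes p: "CARD('p::prime_card) \<ge> 3"
  shows "(\<exists>r :: 'p padic. padic_norm r \<le> 1 \<and> padic_norm (r\<^sup>2 + 1) < 1) \<longleftrightarrow> [CARD('p) = 1] (mod 4)"
proof -
  have int: "padic_norm ((of_int k)\<^sup>2 + 1 :: 'p padic) < 1 \<longleftrightarrow> [k\<^sup>2 = - 1] (mod int CARD('p))" for k
    using padic_norm_of_int_less_1_iff[of "k\<^sup>2 + 1", where 'p = 'p] by (simp add: cong_iff_dvd_diff)
  have "(\<exists>r :: 'p padic. padic_norm r \<le> 1 \<and> padic_norm (r\<^sup>2 + 1) < 1) \<longleftrightarrow> QuadRes (int CARD('p)) (- 1)"
  proof
    assume "\<exists>r :: 'p padic. padic_norm r \<le> 1 \<and> padic_norm (r\<^sup>2 + 1) < 1"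
    then obtain r :: "'p padic" where r: "padic_norm r \<le> 1" "padic_norm (r\<^sup>2 + 1) < 1" by blast
    obtain k where k: "padic_norm (r - of_int k) < 1" using padic_residue_int[OF r(1)] .
    have "padic_norm ((r + of_int k) * (r - of_int k)) < 1"
      by (intro padic_norm_mult_less_1 padic_norm_add_le r k padic_norm_of_int_le_1)
    from padic_norm_diff_less[OF r(2) this] have "padic_norm ((of_int k)\<^sup>2 + 1 :: 'p padic) < 1"
      by (simp add: algebra_simps power2_eq_square)
    thus "QuadRes (int CARD('p)) (- 1)" by (auto simp: int QuadRes_def)
  next
    assume "QuadRes (int CARD('p)) (- 1)"
    then obtain k where "[k\<^sup>2 = - 1] (mod int CARD('p))" by (auto simp: QuadRes_def)
    thus "\<exists>r :: 'p padic. padic_norm r \<le> 1 \<and> padic_norm (r\<^sup>2 + 1) < 1"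
      using padic_norm_of_int_le_1 unfolding int[symmetric] by blast
  qed
  thus ?thesis using QuadRes_minus_one_iff[OF prime_card[where 'a = 'p]] p by simp
qed

theorem theorem3p3:
  fixes a b :: "'p::prime_card padic"
  assumes "CARD('p) \<ge> 3"
    and "a \<in> E_padic" and "b \<in> E_padic" and "b \<noteq> 1"
  shows "(\<exists>!x0. x0 \<in> fixed_points a b \<inter> E_padic) \<and>
    (\<forall>x0. x0 \<in> fixed_points a b \<inter> E_padic \<longrightarrow>
      ([CARD('p) = 3] (mod 4) \<longrightarrow> fixed_points a b = {x0}) \<and>
      ([CARD('p) = 1] (mod 4) \<longrightarrow>
        (\<exists>x1 x2. x1 \<noteq> x2 \<and> x1 \<noteq> x0 \<and> x2 \<noteq> x0 \<and> fixed_points a b = {x0, x1, x2})) \<and>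
      (\<forall>x1 x2. x1 \<in> fixed_points a b \<and> x2 \<in> fixed_points a b \<and> x1 \<noteq> x0 \<and> x2 \<noteq> x0 \<longrightarrow>
        x1 \<notin> E_padic \<and> x2 \<notin> E_padic))"
proof -
  note p = assms(1) and ab = assms(2,3)
  let ?f = "fixed_point_poly a b"
  have roots: "fixed_points a b = {x. poly ?f x = 0}"
    using assms by (rule fixed_points_eq_roots)
  have ex1: "\<exists>!x0. x0 \<in> fixed_points a b \<inter> E_padic"
    using ex1_fixed_point_poly_root_E_padic[OF p ab] by (simp add: roots)
  have three: "fixed_points a b = {x0}"
    if x0: "x0 \<in> fixed_points a b \<inter> E_padic" and p3: "[CARD('p) = 3] (mod 4)" for x0
  proof -
    have "\<not> [CARD('p) = 1] (mod 4)" using p3 by (simp add: cong_def)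
    hence "x \<in> E_padic" if "x \<in> fixed_points a b" for x
      using fixed_point_poly_root_residue[OF ab, of x] padic_sqrt_minus_one_residue_iff[OF p] that
      by (auto simp: roots)
    thus ?thesis using ex1 x0 by blast
  qed
  have one: "\<exists>x1 x2. x1 \<noteq> x2 \<and> x1 \<noteq> x0 \<and> x2 \<noteq> x0 \<and> fixed_points a b = {x0, x1, x2}"
    if x0: "x0 \<in> fixed_points a b \<inter> E_padic" and p1: "[CARD('p) = 1] (mod 4)" for x0
  proof -
    obtain r :: "'p padic" where r: "padic_norm r \<le> 1" "padic_norm (r\<^sup>2 + 1) < 1"
      using padic_sqrt_minus_one_residue_iff[OF p] p1 by blast
    have r': "padic_norm (- r) \<le> 1" "padic_norm ((- r)\<^sup>2 + 1) < 1" using r by simp_all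
    obtain x1 where x1: "poly ?f x1 = 0" "padic_norm (x1 - r) < 1"
      using fixed_point_poly_root_near_sqrt_minus_one[OF p ab r] .
    obtain x2 where x2: "poly ?f x2 = 0" "padic_norm (x2 - - r) < 1"
      using fixed_point_poly_root_near_sqrt_minus_one[OF p ab r'] .
    \<comment> \<open>Roots near different residues are different.\<close>
    have separate: "x \<noteq> y"
      if "padic_norm (x - u) < 1" "padic_norm (y - v) < 1" "padic_norm (u - v) = 1"
      for x y u v :: "'p padic"
      using padic_norm_diff_less[OF that(2,1)] that(3) by auto
    have "padic_norm (r - - r) = padic_norm (2 * r)" by simp
    hence "padic_norm (r - - r) = 1"
      using padic_norm_2[OF p] padic_norm_sqrt_minus_one(1)[OF p r] by (simp only: padic_norm_mult)
    hence x12: "x1 \<noteq> x2" by (rule separate[OF x1(2) x2(2)])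
    have x0': "padic_norm (x0 - 1) < 1" using x0 by (simp add: E_padic_def)
    have x012: "x1 \<noteq> x0" "x2 \<noteq> x0"
      using padic_norm_sqrt_minus_one(2)[OF p r] padic_norm_sqrt_minus_one(2)[OF p r']
      by (intro separate[OF x1(2) x0'] separate[OF x2(2) x0']; simp)+
    \<comment> \<open>A cubic over a field has at most three roots, so these are all of them.\<close>
    have "{x0, x1, x2} = {x. poly ?f x = 0}"
    proof (rule card_seteq)
      have "?f \<noteq> 0" by (simp add: fixed_point_poly_def)
      thus "finite {x. poly ?f x = 0}" by (rule poly_roots_finite)
      have "card {x. poly ?f x = 0} \<le> degree ?f" using \<open>?f \<noteq> 0\<close> by (rule card_poly_roots_bound)
      also have "\<dots> = card {x0, x1, x2}"
        using x12 x012 by (simp add: fixed_point_poly_def)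
      finally show "card {x. poly ?f x = 0} \<le> card {x0, x1, x2}" .
      show "{x0, x1, x2} \<subseteq> {x. poly ?f x = 0}" using x0 x1 x2 by (simp add: roots)
    qed
    with x12 x012 show ?thesis unfolding roots by metis
  qed
  have outside: "x \<notin> E_padic"
    if "x0 \<in> fixed_points a b \<inter> E_padic" "x \<in> fixed_points a b" "x \<noteq> x0" for x0 x
    using ex1 that by blast
  show ?thesis
    by (intro conjI allI impI; (elim conjE)?; (rule ex1 three one outside; assumption))
qed

end
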